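(* Let $K\neq I$ be an $n\times n$ real symmetric positive-definite matrix with largest eigenvalue $\lambda_n$, let $X$ be an $n\times p$ real matrix of full column rank, let $\sigma^2\ge0$ and $\varsigma^2>0$ be real, and let $\Sigma=\sigma^2K+\varsigma^2I$. Put $t=\sigma^2/\varsigma^2$ and $P=I-X(X^{*}X)^{-1}X^{*}$. Then the matrix $$M(t,\varsigma)=\Sigma^{-1}-\Sigma^{-1}X(X^{*}\Sigma^{-1}X)^{-1}X^{*}\Sigma^{-1}$$ can be represented by the series $$M(t,\varsigma)=\varsigma^{-2}\,P\sum_{i=0}^{\infty}(-t\,K P)^{i},$$ and this series is convergent if $t<\lambda_n^{-1}$.
   Context: $(\cdot)^{*}$ is the transpose. The representation by the series means that, whenever $t<\lambda_n^{-1}$, the series converges and its sum equals $M(t,\varsigma)$. *)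

theory Defs
  imports "HOL-Analysis.Analysis"
begin

definition symmetric_matrix :: "real^'n^'n \<Rightarrow> bool" where
  "symmetric_matrix A \<longleftrightarrow> transpose A = A"

definition positive_definite :: "real^'n^'n \<Rightarrow> bool" where
  "positive_definite A \<longleftrightarrow> (\<forall>x. x \<noteq> 0 \<longrightarrow> 0 < x \<bullet> (A *v x))"

definition is_eigenvalue :: "real^'n^'n \<Rightarrow> real \<Rightarrow> bool" where
  "is_eigenvalue A l \<longleftrightarrow> (\<exists>v. v \<noteq> 0 \<and> A *v v = l *\<^sub>R v)"

definition is_largest_eigenvalue :: "real^'n^'n \<Rightarrow> real \<Rightarrow> bool" where
  "is_largest_eigenvalue A l \<longleftrightarrow>
     is_eigenvalue A l \<and> (\<forall>m. is_eigenvalue A m \<longrightarrow> m \<le> l)"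

definition full_column_rank :: "real^'p^'n \<Rightarrow> bool" where
  "full_column_rank A \<longleftrightarrow> rank A = CARD('p)"

(* On real^'n^'n the type class operations 1 and * are entrywise, so powers
   with respect to the matrix product need their own recursion. *)
primrec matrix_pow :: "real^'n^'n \<Rightarrow> nat \<Rightarrow> real^'n^'n" where
  "matrix_pow A 0 = mat 1"
| "matrix_pow A (Suc i) = A ** matrix_pow A i"

definition Sigma_mat :: "real^'n^'n \<Rightarrow> real \<Rightarrow> real \<Rightarrow> real^'n^'n" where
  "Sigma_mat K \<sigma> s = \<sigma>\<^sup>2 *\<^sub>R K + s\<^sup>2 *\<^sub>R mat 1"

definition P_mat :: "real^'p^'n \<Rightarrow> real^'n^'n" where
  "P_mat X = mat 1 - X ** matrix_inv (transpose X ** X) ** transpose X"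

definition M_mat :: "real^'n^'n \<Rightarrow> real^'p^'n \<Rightarrow> real^'n^'n" where
  "M_mat S X =
     matrix_inv S
     - matrix_inv S ** X ** matrix_inv (transpose X ** matrix_inv S ** X)
         ** transpose X ** matrix_inv S"

end

(* Both claims rest on the operator bound |K x| <= lam |x|: the maximum of the Rayleigh quotient is
   an eigenvalue, and Cauchy-Schwarz for the semi-inner product x . K y turns the bound on the
   quadratic form into one on the norm. As P is an orthogonal projection, -tKP has operator norm at
   most t lam < 1, so its powers are summable with sum (I + tKP)^-1. It remains to see that
   M (I + tKP) = s^-2 P, and this follows from M X = 0 (that is, M P = M) together with
   M Sigma P = P, which holds because X^* P = 0. *)

theory Submission
  imports Defs
begin

section \<open>Transposes, differences and inverses of matrices\<close>

lemma inner_transpose_matrix_vector: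
  fixes A :: "real^'m^'n"
  shows "(transpose A *v x) \<bullet> y = x \<bullet> (A *v y)"
  by (simp add: dot_lmul_matrix)

lemma symmetric_matrix_inner:
  assumes "symmetric_matrix A"
  shows "(A *v x) \<bullet> y = x \<bullet> (A *v y)"
  using assms inner_transpose_matrix_vector[of A x y]
  unfolding symmetric_matrix_def by metis

lemma matrix_diff_ldistrib:
  fixes A :: "real^'m^'n" and B C :: "real^'p^'m"
  shows "A ** (B - C) = A ** B - A ** C"
  by (simp add: matrix_eq matrix_vector_mul_assoc[symmetric] algebra_simps)

lemma matrix_diff_rdistrib:
  fixes A B :: "real^'m^'n" and C :: "real^'p^'m"
  shows "(A - B) ** C = A ** C - B ** C"
  by (simp add: matrix_eq matrix_vector_mul_assoc[symmetric] algebra_simps)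

lemma matrix_inv_cancel:
  assumes "invertible A"
  shows "A ** matrix_inv A = mat 1" "matrix_inv A ** A = mat 1"
  using assms someI_ex[of "\<lambda>B. A ** B = mat 1 \<and> B ** A = mat 1"]
  unfolding invertible_def matrix_inv_def by blast+

section \<open>Quadratic forms and the operator bound by the largest eigenvalue\<close>

lemma positive_semidefinite_Cauchy_Schwarz:
  assumes sym: "symmetric_matrix A" and psd: "\<And>x. 0 \<le> x \<bullet> (A *v x)"
  shows "(x \<bullet> (A *v y))\<^sup>2 \<le> (x \<bullet> (A *v x)) * (y \<bullet> (A *v y))"
proof -
  define a b c where "a = x \<bullet> (A *v x)" and "b = x \<bullet> (A *v y)" and "c = y \<bullet> (A *v y)"
  have "y \<bullet> (A *v x) = b"
    using symmetric_matrix_inner[OF sym, of x y] by (simp add: b_def inner_commute)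
  \<comment> \<open>The form at \<open>x + r *\<^sub>R y\<close> is a quadratic polynomial in
    \<open>r\<close> that is never negative; the two cases below pick the values of \<open>r\<close>
    that exploit this.\<close>
  then have q: "0 \<le> a + 2 * r * b + r\<^sup>2 * c" for r
    using psd[of "x + r *\<^sub>R y"]
    by (simp add: a_def b_def c_def algebra_simps inner_add_left inner_add_right power2_eq_square)
  have "b\<^sup>2 \<le> a * c"
  proof (cases "c = 0")
    case True
    have "b = 0"
    proof (rule ccontr)
      assume "b \<noteq> 0"
      \<comment> \<open>With \<open>c = 0\<close> the polynomial is affine in \<open>r\<close>, and
        this \<open>r\<close> makes it equal to -1.\<close>
      with q[of "- (a + 1) / (2 * b)"] True show False by (simp add: field_simps)
    qed
    with True show ?thesis by simp
  next
    case False
    then have "c > 0" using psd[of y] by (simp add: c_def)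
    \<comment> \<open>This is the minimiser of the quadratic, where its value is
      \<open>a - b\<^sup>2 / c\<close>.\<close>
    with q[of "- b / c"] show ?thesis
      by (simp add: field_simps power2_eq_square)
  qed
  then show ?thesis by (simp add: a_def b_def c_def)
qed

lemma Rayleigh_quotient_le:
  assumes sym: "symmetric_matrix A" and max: "is_largest_eigenvalue A l"
  shows "x \<bullet> (A *v x) \<le> l * (x \<bullet> x)"
proof -
  have "continuous_on (sphere 0 1) (\<lambda>x. x \<bullet> (A *v x))"
    by (intro continuous_intros)
  moreover have "sphere (0::real^'a) 1 \<noteq> {}"
    by simp
  ultimately obtain v where v: "norm v = 1"
    and le: "\<And>x. norm x = 1 \<Longrightarrow> x \<bullet> (A *v x) \<le> v \<bullet> (A *v v)"
    using continuous_attains_sup[of "sphere 0 1" "\<lambda>x. x \<bullet> (A *v x)"] by auto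
  define m where "m = v \<bullet> (A *v v)"
  have bound: "x \<bullet> (A *v x) \<le> m * (x \<bullet> x)" for x
  proof (cases "x = 0")
    case False
    then have "norm (x /\<^sub>R norm x) = 1" by simp
    from le[OF this] False show ?thesis
      by (simp add: m_def matrix_vector_mult_scaleR field_simps power2_eq_square
          flip: power2_norm_eq_inner)
  qed simp
  \<comment> \<open>The maximiser \<open>v\<close> is shown to be an eigenvector without
    derivatives: \<open>B\<close> is positive semidefinite by \<open>bound\<close> and its form
    vanishes at \<open>v\<close>, so Cauchy-Schwarz for the pair \<open>B *v v\<close>,
    \<open>v\<close> forces \<open>B *v v = 0\<close>.\<close>
  define B where "B = m *\<^sub>R mat 1 - A"
  have B: "B *v y = m *\<^sub>R y - A *v y" for y
    by (simp add: B_def algebra_simps scaleR_matrix_vector_assoc[symmetric])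
  have "symmetric_matrix B"
    using sym by (simp add: B_def symmetric_matrix_def transpose_def vec_eq_iff mat_def)
  moreover have "0 \<le> y \<bullet> (B *v y)" for y
    using bound[of y] by (simp add: B inner_diff_right)
  moreover have "v \<bullet> (B *v v) = 0"
    using v by (simp add: B inner_diff_right m_def flip: power2_norm_eq_inner)
  ultimately have "((B *v v) \<bullet> (B *v v))\<^sup>2 \<le> 0"
    using positive_semidefinite_Cauchy_Schwarz[of B "B *v v" v] by simp
  then have "A *v v = m *\<^sub>R v"
    by (simp add: B)
  with v max have "m \<le> l"
    unfolding is_largest_eigenvalue_def is_eigenvalue_def by (metis norm_zero zero_neq_one)
  with bound[of x] show ?thesis
    by (meson inner_ge_zero mult_right_mono order_trans)
qed

lemma positive_definite_eigenvalue_pos: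
  assumes "positive_definite A" "is_eigenvalue A l"
  shows "l > 0"
  using assms unfolding positive_definite_def is_eigenvalue_def
  by (metis inner_scaleR_right inner_gt_zero_iff zero_less_mult_pos2)

text \<open>For \<open>y = A *v x\<close>, Cauchy-Schwarz bounds
  \<open>(y \<bullet> (A *v x))\<^sup>2\<close>, the fourth power of the norm of \<open>y\<close>,
  by the product of the forms at \<open>y\<close> and \<open>x\<close>. The Rayleigh bound on each
  form leaves a factor \<open>(norm y)\<^sup>2\<close> to cancel.\<close>

lemma norm_le_largest_eigenvalue:
  assumes sym: "symmetric_matrix A" and pd: "positive_definite A"
    and max: "is_largest_eigenvalue A l"
  shows "norm (A *v x) \<le> l * norm x"
proof -
  let ?y = "A *v x"
  have l: "l > 0"
    using positive_definite_eigenvalue_pos[OF pd] max by (simp add: is_largest_eigenvalue_def)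
  have psd: "0 \<le> z \<bullet> (A *v z)" for z
    using pd by (cases "z = 0") (auto simp: positive_definite_def less_imp_le)
  have "((norm ?y)\<^sup>2)\<^sup>2 = (?y \<bullet> (A *v x))\<^sup>2"
    by (simp add: power2_norm_eq_inner)
  also have "\<dots> \<le> (?y \<bullet> (A *v ?y)) * (x \<bullet> (A *v x))"
    by (rule positive_semidefinite_Cauchy_Schwarz[OF sym psd])
  also have "\<dots> \<le> (l * (?y \<bullet> ?y)) * (l * (x \<bullet> x))"
    using l by (intro mult_mono Rayleigh_quotient_le[OF sym max] psd) auto
  also have "\<dots> = (norm ?y)\<^sup>2 * (l * norm x)\<^sup>2"
    by (simp add: power2_norm_eq_inner[symmetric] power_mult_distrib power2_eq_square)
  finally have "(norm ?y)\<^sup>2 * (norm ?y)\<^sup>2 \<le> (norm ?y)\<^sup>2 * (l * norm x)\<^sup>2"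
    by (simp only: power2_eq_square[of "(norm ?y)\<^sup>2"])
  then have "?y = 0 \<or> (norm ?y)\<^sup>2 \<le> (l * norm x)\<^sup>2"
    by (metis mult_le_cancel_left_pos zero_less_norm_iff zero_less_power)
  then show ?thesis
    using l by (auto intro: power2_le_imp_le)
qed

section \<open>Inverses and congruences of positive-definite matrices\<close>

lemma positive_definite_invertible:
  assumes "positive_definite A"
  shows "invertible A"
proof -
  have "x = 0" if "A *v x = 0" for x
    using assms that unfolding positive_definite_def by (metis inner_zero_right less_irrefl)
  then show ?thesis
    by (metis invertible_left_inverse matrix_left_invertible_ker)
qed

lemma positive_definite_matrix_inv:
  assumes pd: "positive_definite A"
  shows "positive_definite (matrix_inv A)"
  unfolding positive_definite_def
proof (intro allI impI)
  fix x :: "real^'a"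
  assume "x \<noteq> 0"
  have x: "A *v (matrix_inv A *v x) = x"
    by (simp add: matrix_vector_mul_assoc matrix_inv_cancel positive_definite_invertible[OF pd])
  with \<open>x \<noteq> 0\<close> have "matrix_inv A *v x \<noteq> 0" by auto
  then have "0 < (matrix_inv A *v x) \<bullet> (A *v (matrix_inv A *v x))"
    using pd by (simp add: positive_definite_def)
  then show "0 < x \<bullet> (matrix_inv A *v x)"
    by (simp add: x inner_commute)
qed

text \<open>Full column rank makes \<open>X\<close> injective, so the new form at \<open>x\<close>
  is the form of \<open>A\<close> at the nonzero vector \<open>X *v x\<close>. Taking
  \<open>A\<close> as the identity or as an inverse covariance gives the invertibility of the
  matrices inverted in \<open>P_mat\<close> and \<open>M_mat\<close>.\<close>

lemma positive_definite_congruence: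
  fixes A :: "real^'n^'n" and X :: "real^'p^'n"
  assumes pd: "positive_definite A" and X: "full_column_rank X"
  shows "positive_definite (transpose X ** A ** X)"
  unfolding positive_definite_def
proof (intro allI impI)
  fix x :: "real^'p"
  assume "x \<noteq> 0"
  then have "X *v x \<noteq> 0"
    using X by (metis full_column_rank_def matrix_nonfull_linear_equations_eq)
  then have "0 < (X *v x) \<bullet> (A *v (X *v x))"
    using pd by (simp add: positive_definite_def)
  also have "\<dots> = x \<bullet> (transpose X *v (A *v (X *v x)))"
    using inner_transpose_matrix_vector[of X "A *v (X *v x)" x] by (simp add: inner_commute)
  finally show "0 < x \<bullet> ((transpose X ** A ** X) *v x)"
    by (simp only: matrix_vector_mul_assoc matrix_mul_assoc)
qed

lemma positive_definite_mat_1: "positive_definite (mat 1)"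
  by (simp add: positive_definite_def)

lemma positive_definite_Sigma_mat:
  assumes "positive_definite K" "s\<^sup>2 > 0"
  shows "positive_definite (Sigma_mat K \<sigma> s)"
  unfolding positive_definite_def
proof (intro allI impI)
  fix x :: "real^'a"
  assume "x \<noteq> 0"
  then have "0 < x \<bullet> (K *v x)" "0 < s\<^sup>2 * (x \<bullet> x)"
    using assms by (auto simp: positive_definite_def)
  moreover have "x \<bullet> (Sigma_mat K \<sigma> s *v x) = \<sigma>\<^sup>2 * (x \<bullet> (K *v x)) + s\<^sup>2 * (x \<bullet> x)"
    by (simp add: Sigma_mat_def algebra_simps scaleR_matrix_vector_assoc[symmetric] inner_add_right)
  ultimately show "0 < x \<bullet> (Sigma_mat K \<sigma> s *v x)"
    by (simp add: add_nonneg_pos)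
qed

section \<open>The orthogonal projection \<open>P_mat X\<close>\<close>

lemma transpose_mult_P_mat:
  assumes "full_column_rank X"
  shows "transpose X ** P_mat X = 0"
proof -
  have "invertible (transpose X ** X)"
    using positive_definite_congruence[OF positive_definite_mat_1 assms]
    by (simp add: positive_definite_invertible)
  from matrix_inv_cancel(1)[OF this] show ?thesis
    by (simp add: P_mat_def matrix_diff_ldistrib matrix_mul_assoc)
qed

lemma norm_P_mat_le:
  assumes "full_column_rank X"
  shows "norm (P_mat X *v x) \<le> norm x"
proof -
  \<comment> \<open>\<open>w\<close> holds the least-squares coefficients of \<open>x\<close>, so
    \<open>X *v w\<close> is the component of \<open>x\<close> in the column space and
    \<open>P_mat X *v x\<close> the residual, orthogonal to it.\<close>
  define w where "w = (matrix_inv (transpose X ** X) ** transpose X) *v x"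
  have split: "x = P_mat X *v x + X *v w"
    by (simp add: w_def P_mat_def matrix_vector_mul_assoc matrix_mul_assoc algebra_simps)
  have "(P_mat X *v x) \<bullet> (X *v w) = (transpose X *v (P_mat X *v x)) \<bullet> w"
    by (rule inner_transpose_matrix_vector[symmetric])
  also have "transpose X *v (P_mat X *v x) = 0"
    by (simp only: matrix_vector_mul_assoc transpose_mult_P_mat[OF assms] matrix_vector_mult_0)
  finally have "orthogonal (P_mat X *v x) (X *v w)"
    by (simp add: orthogonal_def)
  from norm_add_Pythagorean[OF this] split
  have "(norm x)\<^sup>2 = (norm (P_mat X *v x))\<^sup>2 + (norm (X *v w))\<^sup>2" by metis
  then have "(norm (P_mat X *v x))\<^sup>2 \<le> (norm x)\<^sup>2" by simp
  then show ?thesis by (rule power2_le_imp_le) simp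
qed

section \<open>The Neumann series\<close>

lemma norm_matrix_pow_vector_le:
  assumes "\<And>x. norm (N *v x) \<le> q * norm x" "0 \<le> q"
  shows "norm (matrix_pow N i *v x) \<le> q ^ i * norm x"
proof (induction i)
  case (Suc i)
  have "norm (matrix_pow N (Suc i) *v x) \<le> q * norm (matrix_pow N i *v x)"
    using assms(1)[of "matrix_pow N i *v x"] by (simp add: matrix_vector_mul_assoc)
  also have "\<dots> \<le> q * (q ^ i * norm x)"
    using Suc assms(2) by (rule mult_left_mono)
  finally show ?case by simp
qed simp

text \<open>Summability refers to the norm of the matrix as a vector of vectors, which is Euclidean
  in the entries, whereas contraction is a statement about \<open>onorm\<close>. Every entry is at
  most \<open>onorm\<close> in absolute value; a crude dimension factor does no harm to
  convergence.\<close>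

lemma norm_matrix_le_card_onorm:
  fixes A :: "real^'n^'m"
  shows "norm A \<le> CARD('m) * (CARD('n) * onorm ((*v) A))"
proof -
  have "norm A \<le> (\<Sum>i\<in>UNIV. norm (A $ i))"
    unfolding norm_vec_def[of A] by (rule L2_set_le_sum) simp
  also have "\<dots> \<le> (\<Sum>i\<in>(UNIV::'m set). \<Sum>j\<in>(UNIV::'n set). onorm ((*v) A))"
    by (intro sum_mono order_trans[OF norm_le_l1_cart] matrix_component_le_onorm)
  finally show ?thesis by simp
qed

lemma Neumann_series:
  fixes N :: "real^'n^'n"
  assumes N: "\<And>x. norm (N *v x) \<le> q * norm x" and q: "0 \<le> q" "q < 1"
  shows "summable (matrix_pow N)"
    and "(mat 1 - N) ** (\<Sum>i. matrix_pow N i) = mat 1"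
proof -
  show summ: "summable (matrix_pow N)"
  proof (rule summable_comparison_test)
    let ?C = "real CARD('n) * real CARD('n)"
    have "onorm ((*v) (matrix_pow N i)) \<le> q ^ i" for i
      using norm_matrix_pow_vector_le[OF N q(1)] by (rule onorm_le)
    then have "norm (matrix_pow N i) \<le> ?C * q ^ i" for i
      by (intro order_trans[OF norm_matrix_le_card_onorm]) (simp add: mult.assoc mult_left_mono)
    then show "\<exists>n0. \<forall>i\<ge>n0. norm (matrix_pow N i) \<le> ?C * q ^ i" by blast
    show "summable (\<lambda>i. ?C * q ^ i)"
      using q by (intro summable_mult summable_geometric) simp
  qed
  \<comment> \<open>Left multiplication by \<open>N\<close> is linear on a finite-dimensional space,
    hence continuous, and may be applied to the series termwise; this shifts the index by one and so
    loses exactly the term \<open>mat 1\<close>.\<close>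
  have "linear ((**) N)"
    by (rule linearI) (simp_all add: matrix_add_ldistrib matrix_scalar_ac scalar_matrix_assoc)
  then have "bounded_linear ((**) N)"
    by (simp add: linear_conv_bounded_linear)
  then have "N ** (\<Sum>i. matrix_pow N i) = (\<Sum>i. matrix_pow N (Suc i))"
    using bounded_linear.suminf[OF _ summ] by simp
  also have "\<dots> = (\<Sum>i. matrix_pow N i) - mat 1"
    using suminf_split_head[OF summ] by simp
  finally show "(mat 1 - N) ** (\<Sum>i. matrix_pow N i) = mat 1"
    by (simp add: matrix_diff_rdistrib)
qed

section \<open>Products of \<open>M_mat\<close> with the projection\<close>

lemma M_mat_mult_P_mat:
  assumes S: "positive_definite S" and X: "full_column_rank X"
  shows "M_mat S X ** P_mat X = M_mat S X"
proof -
  define A where "A = transpose X ** matrix_inv S ** X"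
  have "invertible A"
    unfolding A_def
    by (intro positive_definite_invertible positive_definite_congruence
        positive_definite_matrix_inv S X)
  \<comment> \<open>The trailing factors of the second term form \<open>A\<close>, next to its own
    inverse, so that term collapses to the first.\<close>
  have "M_mat S X ** X = matrix_inv S ** X - matrix_inv S ** X ** (matrix_inv A ** A)"
    by (simp add: M_mat_def A_def matrix_diff_rdistrib matrix_mul_assoc)
  then have "M_mat S X ** X = 0"
    by (simp add: matrix_inv_cancel[OF \<open>invertible A\<close>])
  then show ?thesis
    by (simp add: P_mat_def matrix_diff_ldistrib matrix_mul_assoc)
qed

lemma M_mat_mult_mult_P_mat:
  assumes S: "positive_definite S" and X: "full_column_rank X"
  shows "M_mat S X ** S ** P_mat X = P_mat X"
proof -
  \<comment> \<open>Products associate to the left, so the cancelling pair is met behind an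
    arbitrary prefix \<open>Y\<close>.\<close>
  have inv: "Y ** matrix_inv S ** S = Y" for Y :: "real^'a^'c"
    by (simp add: matrix_inv_cancel positive_definite_invertible[OF S] flip: matrix_mul_assoc)
  have "M_mat S X ** S =
      mat 1 - matrix_inv S ** X ** matrix_inv (transpose X ** matrix_inv S ** X) ** transpose X"
    using inv matrix_inv_cancel(2)[OF positive_definite_invertible[OF S]]
    by (simp add: M_mat_def matrix_diff_rdistrib)
  then show ?thesis
    by (simp add: matrix_diff_rdistrib transpose_mult_P_mat[OF X] flip: matrix_mul_assoc)
qed

section \<open>The series representation\<close>

theorem mainTheorem10:
  fixes K :: "real^'n^'n" and X :: "real^'p^'n"
    and \<sigma> s t lam :: real
  assumes "K \<noteq> mat 1"
    and "symmetric_matrix K"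
    and "positive_definite K"
    and "is_largest_eigenvalue K lam"
    and "full_column_rank X"
    and "\<sigma>\<^sup>2 \<ge> 0"
    and "s\<^sup>2 > 0"
    and "t = \<sigma>\<^sup>2 / s\<^sup>2"
    and "t < inverse lam"
  shows "summable (\<lambda>i. matrix_pow ((- t) *\<^sub>R (K ** P_mat X)) i)
    \<and> M_mat (Sigma_mat K \<sigma> s) X =
        inverse (s\<^sup>2) *\<^sub>R
          (P_mat X ** (\<Sum>i. matrix_pow ((- t) *\<^sub>R (K ** P_mat X)) i))"
proof -
  define S M P N where "S = Sigma_mat K \<sigma> s" and "M = M_mat S X" and "P = P_mat X"
    and "N = (- t) *\<^sub>R (K ** P)"
  define R where "R = (\<Sum>i. matrix_pow N i)"
  have lam: "lam > 0"
    using assms(3,4) positive_definite_eigenvalue_pos by (auto simp: is_largest_eigenvalue_def)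
  have t: "t \<ge> 0"
    using assms by simp
  have "norm (N *v x) \<le> (t * lam) * norm x" for x
  proof -
    have "N *v x = (- t) *\<^sub>R (K *v (P *v x))"
      by (simp only: N_def matrix_vector_mul_assoc scaleR_matrix_vector_assoc)
    then have "norm (N *v x) = t * norm (K *v (P *v x))"
      using t by simp
    also have "\<dots> \<le> t * (lam * norm (P *v x))"
      using t by (intro mult_left_mono norm_le_largest_eigenvalue assms)
    also have "\<dots> \<le> t * (lam * norm x)"
      using t lam unfolding P_def by (intro mult_left_mono norm_P_mat_le assms) auto
    finally show ?thesis by simp
  qed
  \<comment> \<open>Since \<open>lam\<close> is positive, the hypothesis
    \<open>t < inverse lam\<close> says that the contraction factor is below 1.\<close>
  moreover have "0 \<le> t * lam" "t * lam < 1"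
    using t lam assms(9) by (auto simp: field_simps)
  ultimately have summ: "summable (matrix_pow N)" and R: "(mat 1 - N) ** R = mat 1"
    unfolding R_def by (rule Neumann_series)+
  have S: "positive_definite S"
    unfolding S_def by (intro positive_definite_Sigma_mat assms)
  have MP: "M ** P = M"
    unfolding M_def P_def by (intro M_mat_mult_P_mat S assms)
  \<comment> \<open>Factoring out \<open>s\<^sup>2\<close> turns the coefficient of
    \<open>K ** P\<close> into \<open>t\<close>, and the sign in \<open>N\<close> gives the
    difference.\<close>
  have SP: "S ** P = s\<^sup>2 *\<^sub>R (P - N)"
    using assms(7,8)
    by (simp add: S_def N_def Sigma_mat_def matrix_eq algebra_simps
        flip: matrix_vector_mul_assoc scaleR_matrix_vector_assoc)
  have "P = M ** (S ** P)"
    using M_mat_mult_mult_P_mat[OF S assms(5)] by (simp add: M_def P_def matrix_mul_assoc)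
  \<comment> \<open>Multiplying by \<open>M\<close> absorbs \<open>P\<close>, which replaces
    \<open>P - N\<close> by \<open>mat 1 - N\<close>; the right inverse \<open>R\<close> then
    cancels it.\<close>
  also have "\<dots> = s\<^sup>2 *\<^sub>R (M ** (mat 1 - N))"
    by (simp add: SP matrix_scalar_ac matrix_diff_ldistrib MP scaleR_diff_right flip: scalar_matrix_assoc)
  finally have "P ** R = s\<^sup>2 *\<^sub>R (M ** ((mat 1 - N) ** R))"
    by (metis matrix_mul_assoc scalar_matrix_assoc)
  then have "M = inverse (s\<^sup>2) *\<^sub>R (P ** R)"
    using assms(7) by (simp add: R)
  with summ show ?thesis
    by (simp add: M_def S_def R_def N_def P_def)
qed

end
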